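(* Let $d_1,\dots,d_n$ be a sequence of possibly dependent, square-integrable real random variables, and let $e_1,\dots,e_n$ be a decoupled sequence of $d_1,\dots,d_n$ (with respect to an increasing sequence of $\sigma$-algebras $\{\mathcal{F}_i\}_{0\le i\le n}$ and given a $\sigma$-algebra $\mathcal{G}$). Put $S_n=\sum_{i=1}^n d_i$ and $S'_n=\sum_{i=1}^n e_i$. Then for every $t>0$, $$\mathbb{P}\left(|S_n-\mathbb{E}S_n|>t\right)\le\frac{2\operatorname{Var}(S'_n)}{t^2}.$$ If in addition $S_n\ge 0$ almost surely, then for every $0<\theta<1$, $$\mathbb{P}\left(S_n>\theta\,\mathbb{E}S_n\right)\ge(1-\theta)^2\,\frac{(\mathbb{E}S_n)^2}{2\,\mathbb{E}[(S'_n)^2]-(\mathbb{E}S_n)^2}=(1-\theta)^2\,\frac{1}{\frac{2\,\mathbb{E}[(S'_n)^2]}{(\mathbb{E}S_n)^2}-1}.$$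
   Context: All random variables are defined on a probability space $(\Omega,\mathcal{F},\mathbb{P})$ and are square-integrable. $\mathcal{L}(X\mid\mathcal{H})$ denotes the conditional law of $X$ given a $\sigma$-algebra $\mathcal{H}$. Let $\mathcal{F}_0\subseteq\mathcal{F}_1\subseteq\dots\subseteq\mathcal{F}_n\subseteq\mathcal{F}$ be $\sigma$-algebras and let $\{d_i\}_{1\le i\le n}$, $\{e_i\}_{1\le i\le n}$ be sequences adapted to $\{\mathcal{F}_i\}$ (i.e. $d_i,e_i$ are $\mathcal{F}_i$-measurable). (Tangent) $\{d_i\}$ is tangent to $\{e_i\}$ with respect to $\{\mathcal{F}_i\}$ if $\mathcal{L}(d_i\mid\mathcal{F}_{i-1})=\mathcal{L}(e_i\mid\mathcal{F}_{i-1})$ for all $i$. (Conditionally independent, CI) $\{e_i\}$ is CI if there is a $\sigma$-algebra $\mathcal{G}\subseteq\mathcal{F}$ such that $e_1,\dots,e_n$ are conditionally independent given $\mathcal{G}$ and $\mathcal{L}(e_i\mid\mathcal{F}_{i-1})=\mathcal{L}(e_i\mid\mathcal{G})$ for all $i$. (Decoupled) $\{e_i\}$ is a decoupled sequence (decoupled version) of $\{d_i\}$, given $\mathcal{G}$, if $\{e_i\}$ is CI with this $\mathcal{G}$ and is tangent to $\{d_i\}$ with respect to $\{\mathcal{F}_i\}$. *)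

theory Defs
  imports "HOL-Probability.Probability"
begin

text \<open>
  A sub-sigma-algebra of \<^term>\<open>M\<close> is represented, as in the library, by a measure
  \<^term>\<open>H\<close> with \<^term>\<open>subalgebra M H\<close>; only the space and the measurable sets of
  \<^term>\<open>H\<close> matter.
\<close>

definition cond_prob :: "'a measure \<Rightarrow> 'a measure \<Rightarrow> 'a set \<Rightarrow> 'a \<Rightarrow> real" where
  "cond_prob M H A = real_cond_exp M H (indicator A)"

definition cond_law :: "'a measure \<Rightarrow> 'a measure \<Rightarrow> ('a \<Rightarrow> real) \<Rightarrow> real set \<Rightarrow> 'a \<Rightarrow> real" where
  "cond_law M H X B = cond_prob M H (X -` B \<inter> space M)"

text \<open>
  Equality of the conditional law of \<open>X\<close> given \<open>H\<close> and that of \<open>Y\<close> given \<open>K\<close>: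
  the conditional probabilities of each Borel set agree almost surely. The exceptional null
  set may depend on the Borel set; since the Borel sets of the reals are countably generated,
  this amounts to almost sure equality of regular versions as random measures.
\<close>

definition cond_law_eq ::
  "'a measure \<Rightarrow> 'a measure \<Rightarrow> ('a \<Rightarrow> real) \<Rightarrow> 'a measure \<Rightarrow> ('a \<Rightarrow> real) \<Rightarrow> bool" where
  "cond_law_eq M H X K Y \<longleftrightarrow>
     (\<forall>B\<in>sets borel. AE \<omega> in M. cond_law M H X B \<omega> = cond_law M K Y B \<omega>)"

definition cond_indep_vars ::
  "'a measure \<Rightarrow> 'a measure \<Rightarrow> ('i \<Rightarrow> 'a \<Rightarrow> real) \<Rightarrow> 'i set \<Rightarrow> bool" where
  "cond_indep_vars M G X I \<longleftrightarrow>
     (\<forall>J B. J \<subseteq> I \<longrightarrow> finite J \<longrightarrow> J \<noteq> {} \<longrightarrow> (\<forall>i\<in>J. B i \<in> sets borel) \<longrightarrow>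
       (AE \<omega> in M. cond_prob M G {\<omega>\<in>space M. \<forall>i\<in>J. X i \<omega> \<in> B i} \<omega>
                    = (\<Prod>i\<in>J. cond_law M G (X i) (B i) \<omega>)))"

text \<open>
  In the following, the sigma-algebras are \<open>F 0, \<dots>, F n\<close> and the sequences are
  indexed by \<open>1, \<dots>, n\<close>; values at other indices are irrelevant.
\<close>

definition finite_filtration :: "'a measure \<Rightarrow> nat \<Rightarrow> (nat \<Rightarrow> 'a measure) \<Rightarrow> bool" where
  "finite_filtration M n F \<longleftrightarrow>
     (\<forall>i\<le>n. subalgebra M (F i)) \<and> (\<forall>i<n. subalgebra (F (Suc i)) (F i))"

definition adapted_seq :: "nat \<Rightarrow> (nat \<Rightarrow> 'a measure) \<Rightarrow> (nat \<Rightarrow> 'a \<Rightarrow> real) \<Rightarrow> bool" where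
  "adapted_seq n F X \<longleftrightarrow> (\<forall>i\<in>{1..n}. X i \<in> borel_measurable (F i))"

definition tangent ::
  "'a measure \<Rightarrow> nat \<Rightarrow> (nat \<Rightarrow> 'a measure) \<Rightarrow> (nat \<Rightarrow> 'a \<Rightarrow> real) \<Rightarrow> (nat \<Rightarrow> 'a \<Rightarrow> real) \<Rightarrow> bool"
  where
  "tangent M n F d e \<longleftrightarrow> (\<forall>i\<in>{1..n}. cond_law_eq M (F (i - 1)) (d i) (F (i - 1)) (e i))"

definition CI_given ::
  "'a measure \<Rightarrow> nat \<Rightarrow> (nat \<Rightarrow> 'a measure) \<Rightarrow> 'a measure \<Rightarrow> (nat \<Rightarrow> 'a \<Rightarrow> real) \<Rightarrow> bool"
  where
  "CI_given M n F G e \<longleftrightarrow>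
     subalgebra M G \<and> cond_indep_vars M G e {1..n} \<and>
     (\<forall>i\<in>{1..n}. cond_law_eq M (F (i - 1)) (e i) G (e i))"

definition decoupled_given ::
  "'a measure \<Rightarrow> nat \<Rightarrow> (nat \<Rightarrow> 'a measure) \<Rightarrow> 'a measure \<Rightarrow>
   (nat \<Rightarrow> 'a \<Rightarrow> real) \<Rightarrow> (nat \<Rightarrow> 'a \<Rightarrow> real) \<Rightarrow> bool"
  where
  "decoupled_given M n F G d e \<longleftrightarrow> CI_given M n F G e \<and> tangent M n F d e"

end

theory Submission
  imports Defs
begin

text \<open>
  Write \<open>a i\<close> for the common value of \<open>E[d i | F (i - 1)]\<close> and \<open>E[e i | G]\<close>, and
  \<open>m\<close> for the common mean of the two sums. The sum \<open>S - m\<close> splits as the sum of the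
  martingale differences \<open>d i - a i\<close> plus \<open>\<Sum>i. a i - m\<close>, and \<open>S' - m\<close> splits as the sum
  of the \<open>e i - a i\<close>, which are conditionally orthogonal given \<open>G\<close>, plus the same remainder.
  Both families are orthogonal in the Hilbert space of square-integrable variables and \<open>d i\<close>,
  \<open>e i\<close> have the same law, so the first parts have equal second moments. For \<open>S'\<close> the two
  parts are moreover orthogonal to each other, while for \<open>S\<close> one only has
  \<open>(x + y)\<^sup>2 \<le> 2 x\<^sup>2 + 2 y\<^sup>2\<close>; hence \<open>Var S \<le> 2 Var S'\<close>. The tail bounds are then those of
  Chebyshev and Paley--Zygmund.
\<close>

section \<open>Integrals determined by laws\<close>

text \<open>Both sides are integrals of \<open>f\<close> against image measures, and
  \<open>eq\<close> says that the image of \<open>density M w\<close> under \<open>X\<close> and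
  that of \<open>density M v\<close> under \<open>Y\<close> agree on Borel sets. The weights make it
  possible to test equal conditional laws against events without regular versions.\<close>

lemma weighted_integral_eqI:
  fixes X Y w v :: "'a \<Rightarrow> real" and f :: "real \<Rightarrow> real"
  assumes [measurable]: "X \<in> borel_measurable M" "Y \<in> borel_measurable M" "f \<in> borel_measurable borel"
    and int: "integrable M w" "integrable M v"
    and nn: "AE \<omega> in M. 0 \<le> w \<omega>" "AE \<omega> in M. 0 \<le> v \<omega>"
    and eq: "\<And>B. B \<in> sets borel \<Longrightarrow>
      (\<integral>\<omega>. w \<omega> * indicator (X -` B \<inter> space M) \<omega> \<partial>M) = (\<integral>\<omega>. v \<omega> * indicator (Y -` B \<inter> space M) \<omega> \<partial>M)"
  shows "(\<integral>\<omega>. w \<omega> * f (X \<omega>) \<partial>M) = (\<integral>\<omega>. v \<omega> * f (Y \<omega>) \<partial>M)"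
proof -
  have [measurable]: "w \<in> borel_measurable M" "v \<in> borel_measurable M"
    using int by auto
  \<comment> \<open>Integrable weights give finite measures, so the value on a Borel set is a real
    integral, the form in which \<open>eq\<close> is given.\<close>
  have weigh: "emeasure (distr (density M u) borel Z) B
      = ennreal (\<integral>\<omega>. u \<omega> * indicator (Z -` B \<inter> space M) \<omega> \<partial>M)"
    if [measurable]: "Z \<in> borel_measurable M" "B \<in> sets borel"
      and u: "integrable M u" "AE \<omega> in M. 0 \<le> u \<omega>"
    for u :: "'a \<Rightarrow> real" and Z :: "'a \<Rightarrow> real" and B
  proof -
    have [measurable]: "u \<in> borel_measurable M" using u by auto
    have "emeasure (distr (density M u) borel Z) B
        = (\<integral>\<^sup>+\<omega>. ennreal (u \<omega>) * indicator (Z -` B \<inter> space M) \<omega> \<partial>M)"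
      by (subst emeasure_distr) (simp_all add: emeasure_density)
    also have "\<dots> = (\<integral>\<^sup>+\<omega>. ennreal (u \<omega> * indicator (Z -` B \<inter> space M) \<omega>) \<partial>M)"
      by (intro nn_integral_cong) (auto split: split_indicator)
    also have "\<dots> = ennreal (\<integral>\<omega>. u \<omega> * indicator (Z -` B \<inter> space M) \<omega> \<partial>M)"
      using u by (intro nn_integral_eq_integral integrable_real_mult_indicator) auto
    finally show ?thesis .
  qed
  have law: "distr (density M w) borel X = distr (density M v) borel Y"
    by (rule measure_eqI) (use weigh int nn eq in auto)
  have transfer: "(\<integral>\<omega>. u \<omega> * f (Z \<omega>) \<partial>M) = integral\<^sup>L (distr (density M u) borel Z) f"
    if [measurable]: "Z \<in> borel_measurable M" "u \<in> borel_measurable M"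
      and "AE \<omega> in M. 0 \<le> u \<omega>" for u Z :: "'a \<Rightarrow> real"
    using that by (subst integral_distr) (simp_all add: integral_density)
  show ?thesis
    using nn by (simp add: transfer law)
qed

lemma (in finite_measure) sigma_finite_subalgebraI:
  "subalgebra M H \<Longrightarrow> sigma_finite_subalgebra M H"
  by (intro finite_measure_subalgebra_is_sigma_finite finite_measure_subalgebra.intro
      finite_measure_subalgebra_axioms.intro finite_measure_axioms)

lemma (in finite_measure) integrable_indicator_event:
  "A \<in> sets M \<Longrightarrow> integrable M (indicator A :: 'a \<Rightarrow> real)"
  by (simp add: less_top[symmetric])

lemma (in finite_measure)
  assumes "subalgebra M H" and [measurable]: "A \<in> sets M"
  shows cond_exp_indicator_nonneg: "AE \<omega> in M. 0 \<le> real_cond_exp M H (indicator A) \<omega>"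
    and cond_exp_indicator_le_1: "AE \<omega> in M. real_cond_exp M H (indicator A) \<omega> \<le> 1"
    and integrable_cond_exp_indicator: "integrable M (real_cond_exp M H (indicator A))"
proof -
  interpret sigma_finite_subalgebra M H using assms(1) by (rule sigma_finite_subalgebraI)
  show "AE \<omega> in M. 0 \<le> real_cond_exp M H (indicator A) \<omega>" by (rule real_cond_exp_pos) auto
  show "AE \<omega> in M. real_cond_exp M H (indicator A) \<omega> \<le> 1"
    by (rule real_cond_exp_le_c) (auto simp: integrable_indicator_event)
  show "integrable M (real_cond_exp M H (indicator A))"
    by (simp add: real_cond_exp_int integrable_indicator_event)
qed

text \<open>Both sides equal the integral of the product of the two conditional expectations: an
  \<open>H\<close>-measurable factor is pulled out once on each side. The products are integrable
  because one factor lies between 0 and 1.\<close>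

lemma (in finite_measure) cond_exp_indicator_self_adjoint:
  fixes X :: "'a \<Rightarrow> real"
  assumes H: "subalgebra M H" and [measurable]: "A \<in> sets M" and X: "integrable M X"
  shows "(\<integral>\<omega>. real_cond_exp M H (indicator A) \<omega> * X \<omega> \<partial>M)
    = (\<integral>\<omega>. indicator A \<omega> * real_cond_exp M H X \<omega> \<partial>M)"
proof -
  interpret sigma_finite_subalgebra M H using H by (rule sigma_finite_subalgebraI)
  have [measurable]: "X \<in> borel_measurable M" using X by simp
  have "integrable M (\<lambda>\<omega>. real_cond_exp M H (indicator A) \<omega> * X \<omega>)"
  proof (rule Bochner_Integration.integrable_bound[OF X])
    have "AE \<omega> in M. 0 \<le> real_cond_exp M H (indicator A) \<omega>"
      "AE \<omega> in M. real_cond_exp M H (indicator A) \<omega> \<le> 1"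
      by (simp_all add: cond_exp_indicator_nonneg cond_exp_indicator_le_1 H)
    then show "AE \<omega> in M. norm (real_cond_exp M H (indicator A) \<omega> * X \<omega>) \<le> norm (X \<omega>)"
      by eventually_elim (simp add: abs_mult mult_left_le_one_le)
  qed simp
  then have "(\<integral>\<omega>. real_cond_exp M H (indicator A) \<omega> * X \<omega> \<partial>M)
      = (\<integral>\<omega>. real_cond_exp M H (indicator A) \<omega> * real_cond_exp M H X \<omega> \<partial>M)"
    by (intro real_cond_exp_intg(2)[symmetric]) auto
  also have "\<dots> = (\<integral>\<omega>. real_cond_exp M H X \<omega> * indicator A \<omega> \<partial>M)"
  proof (subst mult.commute, rule real_cond_exp_intg(2))
    show "integrable M (\<lambda>\<omega>. real_cond_exp M H X \<omega> * indicator A \<omega>)"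
      using X by (intro integrable_real_mult_indicator real_cond_exp_int) auto
  qed auto
  finally show ?thesis by (simp add: mult.commute)
qed

text \<open>Self-adjointness turns the integral of \<open>E[X | H]\<close> over \<open>A\<close>
  into the integral of \<open>X\<close> with weight \<open>P(A | H)\<close>. The same identity for
  indicators of \<open>X\<close> and \<open>Y\<close> shows that the two weighted laws agree. Since
  \<open>H\<close> and \<open>K\<close> may be unrelated, the test runs over all events
  \<open>A\<close> of \<open>M\<close>.\<close>

lemma (in finite_measure) cond_law_eq_cond_exp:
  assumes H: "subalgebra M H" and K: "subalgebra M K"
    and X: "integrable M X" and Y: "integrable M Y"
    and eq: "cond_law_eq M H X K Y"
  shows "AE \<omega> in M. real_cond_exp M H X \<omega> = real_cond_exp M K Y \<omega>"
proof (rule density_unique_real)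
  have [measurable]: "X \<in> borel_measurable M" "Y \<in> borel_measurable M" using X Y by auto
  show "integrable M (real_cond_exp M H X)" "integrable M (real_cond_exp M K Y)"
    using sigma_finite_subalgebra.real_cond_exp_int(1)[OF sigma_finite_subalgebraI] H K X Y by auto
  fix A assume A[measurable]: "A \<in> sets M"
  let ?w = "real_cond_exp M H (indicator A)" and ?v = "real_cond_exp M K (indicator A)"
  have "(\<integral>\<omega>. ?w \<omega> * X \<omega> \<partial>M) = (\<integral>\<omega>. ?v \<omega> * Y \<omega> \<partial>M)"
  proof (rule weighted_integral_eqI[where f = "\<lambda>x. x"])
    fix B :: "real set" assume [measurable]: "B \<in> sets borel"
    have "AE \<omega> in M. real_cond_exp M H (indicator (X -` B \<inter> space M)) \<omega>
        = real_cond_exp M K (indicator (Y -` B \<inter> space M)) \<omega>"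
      using eq by (simp add: cond_law_eq_def cond_law_def cond_prob_def)
    then have "(\<integral>\<omega>. indicator A \<omega> * real_cond_exp M H (indicator (X -` B \<inter> space M)) \<omega> \<partial>M)
        = (\<integral>\<omega>. indicator A \<omega> * real_cond_exp M K (indicator (Y -` B \<inter> space M)) \<omega> \<partial>M)"
      by (intro integral_cong_AE) (auto simp: borel_measurable_cond_exp2)
    then show "(\<integral>\<omega>. ?w \<omega> * indicator (X -` B \<inter> space M) \<omega> \<partial>M)
        = (\<integral>\<omega>. ?v \<omega> * indicator (Y -` B \<inter> space M) \<omega> \<partial>M)"
      by (simp add: cond_exp_indicator_self_adjoint integrable_indicator_event H K)
  qed (simp_all add: integrable_cond_exp_indicator cond_exp_indicator_nonneg H K)
  then show "(\<integral>\<omega>\<in>A. real_cond_exp M H X \<omega> \<partial>M) = (\<integral>\<omega>\<in>A. real_cond_exp M K Y \<omega> \<partial>M)"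
    by (simp add: cond_exp_indicator_self_adjoint H K X Y set_lebesgue_integral_def)
qed

text \<open>Conditional probabilities integrate to unconditional ones, so equal conditional laws
  force equal laws; this is the case of constant weight 1.\<close>

lemma (in finite_measure) cond_law_eq_integral:
  fixes f :: "real \<Rightarrow> real"
  assumes H: "subalgebra M H" and K: "subalgebra M K"
    and [measurable]: "X \<in> borel_measurable M" "Y \<in> borel_measurable M" "f \<in> borel_measurable borel"
    and eq: "cond_law_eq M H X K Y"
  shows "(\<integral>\<omega>. f (X \<omega>) \<partial>M) = (\<integral>\<omega>. f (Y \<omega>) \<partial>M)"
proof -
  have "(\<integral>\<omega>. 1 * f (X \<omega>) \<partial>M) = (\<integral>\<omega>. 1 * f (Y \<omega>) \<partial>M)"
  proof (rule weighted_integral_eqI[where X = X and Y = Y and f = f])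
    fix B :: "real set" assume [measurable]: "B \<in> sets borel"
    have "AE \<omega> in M. real_cond_exp M H (indicator (X -` B \<inter> space M)) \<omega>
        = real_cond_exp M K (indicator (Y -` B \<inter> space M)) \<omega>"
      using eq by (simp add: cond_law_eq_def cond_law_def cond_prob_def)
    then have "(\<integral>\<omega>. real_cond_exp M H (indicator (X -` B \<inter> space M)) \<omega> \<partial>M)
        = (\<integral>\<omega>. real_cond_exp M K (indicator (Y -` B \<inter> space M)) \<omega> \<partial>M)"
      by (intro integral_cong_AE) (auto simp: borel_measurable_cond_exp2)
    then show "(\<integral>\<omega>. (1::real) * indicator (X -` B \<inter> space M) \<omega> \<partial>M)
        = (\<integral>\<omega>. 1 * indicator (Y -` B \<inter> space M) \<omega> \<partial>M)"
      by (simp add: sigma_finite_subalgebra.real_cond_exp_int sigma_finite_subalgebraI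
          integrable_indicator_event H K)
  qed simp_all
  then show ?thesis by simp
qed

section \<open>Orthogonality\<close>

lemma integrable_mult_L2:
  fixes X Y :: "'a \<Rightarrow> real"
  assumes [measurable]: "X \<in> borel_measurable M" "Y \<in> borel_measurable M"
    and "integrable M (\<lambda>\<omega>. (X \<omega>)\<^sup>2)" "integrable M (\<lambda>\<omega>. (Y \<omega>)\<^sup>2)"
  shows "integrable M (\<lambda>\<omega>. X \<omega> * Y \<omega>)"
proof (rule Bochner_Integration.integrable_bound)
  show "integrable M (\<lambda>\<omega>. (X \<omega>)\<^sup>2 + (Y \<omega>)\<^sup>2)" using assms by simp
  have "\<bar>x * y\<bar> \<le> x\<^sup>2 + y\<^sup>2" for x y :: real
  proof -
    have "2 * (\<bar>x\<bar> * \<bar>y\<bar>) \<le> x\<^sup>2 + y\<^sup>2" "0 \<le> \<bar>x\<bar> * \<bar>y\<bar>"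
      using sum_squares_bound[of "\<bar>x\<bar>" "\<bar>y\<bar>"] by (simp_all add: mult.assoc)
    then show ?thesis unfolding abs_mult by linarith
  qed
  then show "AE \<omega> in M. norm (X \<omega> * Y \<omega>) \<le> norm ((X \<omega>)\<^sup>2 + (Y \<omega>)\<^sup>2)" by simp
qed simp

lemma integrable_add_L2:
  fixes X Y :: "'a \<Rightarrow> real"
  assumes [measurable]: "X \<in> borel_measurable M" "Y \<in> borel_measurable M"
    and "integrable M (\<lambda>\<omega>. (X \<omega>)\<^sup>2)" "integrable M (\<lambda>\<omega>. (Y \<omega>)\<^sup>2)"
  shows "integrable M (\<lambda>\<omega>. (X \<omega> + Y \<omega>)\<^sup>2)"
  using integrable_mult_L2[OF assms] assms by (simp add: power2_sum mult.assoc)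

lemma integrable_diff_L2:
  fixes X Y :: "'a \<Rightarrow> real"
  assumes [measurable]: "X \<in> borel_measurable M" "Y \<in> borel_measurable M"
    and "integrable M (\<lambda>\<omega>. (X \<omega>)\<^sup>2)" "integrable M (\<lambda>\<omega>. (Y \<omega>)\<^sup>2)"
  shows "integrable M (\<lambda>\<omega>. (X \<omega> - Y \<omega>)\<^sup>2)"
  using integrable_mult_L2[OF assms] assms by (simp add: power2_diff mult.assoc)

lemma integrable_sum_L2:
  fixes X :: "'i \<Rightarrow> 'a \<Rightarrow> real"
  assumes "finite I" "\<And>i. i \<in> I \<Longrightarrow> X i \<in> borel_measurable M"
    and "\<And>i. i \<in> I \<Longrightarrow> integrable M (\<lambda>\<omega>. (X i \<omega>)\<^sup>2)"
  shows "integrable M (\<lambda>\<omega>. (\<Sum>i\<in>I. X i \<omega>)\<^sup>2)"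
  using assms by (induction I rule: finite_induct) (auto intro!: integrable_add_L2)

text \<open>Pythagoras: when the square is expanded into a double sum, only the diagonal
  survives.\<close>

lemma integral_square_sum_orthogonal:
  fixes X :: "'i \<Rightarrow> 'a \<Rightarrow> real"
  assumes "finite I" and meas: "\<And>i. i \<in> I \<Longrightarrow> X i \<in> borel_measurable M"
    and sq: "\<And>i. i \<in> I \<Longrightarrow> integrable M (\<lambda>\<omega>. (X i \<omega>)\<^sup>2)"
    and orth: "\<And>i j. i \<in> I \<Longrightarrow> j \<in> I \<Longrightarrow> i \<noteq> j \<Longrightarrow> (\<integral>\<omega>. X i \<omega> * X j \<omega> \<partial>M) = 0"
  shows "(\<integral>\<omega>. (\<Sum>i\<in>I. X i \<omega>)\<^sup>2 \<partial>M) = (\<Sum>i\<in>I. \<integral>\<omega>. (X i \<omega>)\<^sup>2 \<partial>M)"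
proof -
  have int: "integrable M (\<lambda>\<omega>. X i \<omega> * X j \<omega>)" if "i \<in> I" "j \<in> I" for i j
    using that by (intro integrable_mult_L2 meas sq)
  have "(\<integral>\<omega>. (\<Sum>i\<in>I. X i \<omega>)\<^sup>2 \<partial>M) = (\<integral>\<omega>. (\<Sum>i\<in>I. \<Sum>j\<in>I. X i \<omega> * X j \<omega>) \<partial>M)"
    by (simp add: power2_eq_square sum_product)
  also have "\<dots> = (\<Sum>i\<in>I. \<Sum>j\<in>I. \<integral>\<omega>. X i \<omega> * X j \<omega> \<partial>M)"
    using int by (simp add: Bochner_Integration.integrable_sum)
  also have "\<dots> = (\<Sum>i\<in>I. \<Sum>j\<in>I. if i = j then \<integral>\<omega>. (X i \<omega>)\<^sup>2 \<partial>M else 0)"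
    using orth by (intro sum.cong) (auto simp: power2_eq_square)
  also have "\<dots> = (\<Sum>i\<in>I. \<integral>\<omega>. (X i \<omega>)\<^sup>2 \<partial>M)"
    using \<open>finite I\<close> by simp
  finally show ?thesis .
qed

section \<open>Conditional expectation as orthogonal projection\<close>

context sigma_finite_subalgebra
begin

text \<open>Conditional Jensen for the square bounds the integrand by
  \<open>E[X\<^sup>2 | F]\<close>, which is integrable.\<close>

lemma integrable_cond_exp_L2:
  assumes X: "integrable M X" and sq: "integrable M (\<lambda>\<omega>. (X \<omega>)\<^sup>2)"
  shows "integrable M (\<lambda>\<omega>. (real_cond_exp M F X \<omega>)\<^sup>2)"
proof (rule Bochner_Integration.integrable_bound)
  show "integrable M (real_cond_exp M F (\<lambda>\<omega>. (X \<omega>)\<^sup>2))" using sq by (rule real_cond_exp_int)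
  have "AE \<omega> in M. (real_cond_exp M F X \<omega>)\<^sup>2 \<le> real_cond_exp M F (\<lambda>\<omega>. (X \<omega>)\<^sup>2) \<omega>"
    by (rule real_cond_exp_jensens_inequality(2)[where I = UNIV])
       (auto simp: X sq intro: convex_power2)
  then show "AE \<omega> in M. norm ((real_cond_exp M F X \<omega>)\<^sup>2) \<le> norm (real_cond_exp M F (\<lambda>\<omega>. (X \<omega>)\<^sup>2) \<omega>)"
    by auto
qed (auto simp: borel_measurable_cond_exp2)

text \<open>As \<open>Z\<close> is \<open>F\<close>-measurable, \<open>Z * X\<close> and
  \<open>Z * E[X | F]\<close> have the same integral. This gives both the orthogonality of
  martingale differences and that of \<open>e j - E[e j | G]\<close> to \<open>G\<close>-measurable
  variables.\<close>

lemma integral_mult_diff_cond_exp: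
  fixes X Z :: "'a \<Rightarrow> real"
  assumes [measurable]: "Z \<in> borel_measurable F" "X \<in> borel_measurable M"
    and "integrable M (\<lambda>\<omega>. Z \<omega> * X \<omega>)"
  shows "(\<integral>\<omega>. Z \<omega> * (X \<omega> - real_cond_exp M F X \<omega>) \<partial>M) = 0"
  using real_cond_exp_intg[of Z X] assms by (simp add: right_diff_distrib)

text \<open>Pythagoras for the projection: \<open>?a\<close> is \<open>F\<close>-measurable, so the
  cross term \<open>?a * X\<close> integrates to the second moment of \<open>?a\<close>.\<close>

lemma integral_square_diff_cond_exp:
  assumes X: "integrable M X" and sq: "integrable M (\<lambda>\<omega>. (X \<omega>)\<^sup>2)"
  shows "(\<integral>\<omega>. (X \<omega> - real_cond_exp M F X \<omega>)\<^sup>2 \<partial>M)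
    = (\<integral>\<omega>. (X \<omega>)\<^sup>2 \<partial>M) - (\<integral>\<omega>. (real_cond_exp M F X \<omega>)\<^sup>2 \<partial>M)"
proof -
  let ?a = "real_cond_exp M F X"
  have [measurable]: "X \<in> borel_measurable M" using X by simp
  have a: "integrable M (\<lambda>\<omega>. (?a \<omega>)\<^sup>2)" using X sq by (rule integrable_cond_exp_L2)
  have aX: "integrable M (\<lambda>\<omega>. ?a \<omega> * X \<omega>)"
    by (rule integrable_mult_L2[OF _ _ a sq]) (auto simp: borel_measurable_cond_exp2)
  have "(\<integral>\<omega>. ?a \<omega> * X \<omega> \<partial>M) = (\<integral>\<omega>. (?a \<omega>)\<^sup>2 \<partial>M)"
    using real_cond_exp_intg(2)[OF aX] by (simp add: power2_eq_square)
  moreover have "(\<integral>\<omega>. (X \<omega> - ?a \<omega>)\<^sup>2 \<partial>M) = (\<integral>\<omega>. (X \<omega>)\<^sup>2 + (?a \<omega>)\<^sup>2 - 2 * (?a \<omega> * X \<omega>) \<partial>M)"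
    by (simp add: power2_diff algebra_simps)
  ultimately show ?thesis
    using a aX sq by simp
qed

end

text \<open>
  Conditional independence of the events \<open>{Y \<in> C}\<close> and \<open>{X \<in> B}\<close> says that, for fixed \<open>C\<close>,
  \<open>X\<close> has the same law under the weights \<open>1\<^sub>C (Y)\<close> and \<open>P(Y \<in> C | G)\<close>; integrating \<open>X\<close>
  against both shows that \<open>X - E[X | G]\<close> has vanishing conditional expectation given \<open>Y\<close>.
\<close>

lemma (in prob_space) integral_mult_diff_cond_exp_cond_indep:
  fixes X Y :: "'a \<Rightarrow> real"
  assumes G: "subalgebra M G" and X: "integrable M X" and [measurable]: "Y \<in> borel_measurable M"
    and XY: "integrable M (\<lambda>\<omega>. Y \<omega> * (X \<omega> - real_cond_exp M G X \<omega>))"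
    and ci: "\<And>B C. B \<in> sets borel \<Longrightarrow> C \<in> sets borel \<Longrightarrow>
      AE \<omega> in M. cond_prob M G {\<omega> \<in> space M. X \<omega> \<in> B \<and> Y \<omega> \<in> C} \<omega>
        = cond_law M G X B \<omega> * cond_law M G Y C \<omega>"
  shows "(\<integral>\<omega>. Y \<omega> * (X \<omega> - real_cond_exp M G X \<omega>) \<partial>M) = 0"
proof -
  have [measurable]: "X \<in> borel_measurable M" using X by simp
  interpret G: sigma_finite_subalgebra M G using G by (rule sigma_finite_subalgebraI)
  \<comment> \<open>\<open>?H\<close> is the sigma-algebra generated by \<open>Y\<close>.\<close>
  let ?a = "real_cond_exp M G X" and ?H = "vimage_algebra (space M) Y borel"
  have a: "integrable M ?a" using X by (rule G.real_cond_exp_int)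
  note [simp] = integrable_indicator_event
  have H: "subalgebra M ?H"
    by (auto simp: subalgebra_def sets_vimage_algebra2)
  interpret H: sigma_finite_subalgebra M ?H using H by (rule sigma_finite_subalgebraI)
  have key: "(\<integral>\<omega>. indicator (Y -` C \<inter> space M) \<omega> * X \<omega> \<partial>M)
      = (\<integral>\<omega>. indicator (Y -` C \<inter> space M) \<omega> * ?a \<omega> \<partial>M)"
    if [measurable]: "C \<in> sets borel" for C
  proof -
    let ?C = "Y -` C \<inter> space M"
    let ?w = "real_cond_exp M G (indicator ?C)"
    \<comment> \<open>Conditional independence factors the conditional probability of the
      intersection of \<open>?B\<close> and \<open>?C\<close>; since \<open>?w\<close> is
      \<open>G\<close>-measurable, the conditioning on the factor for \<open>?B\<close> can then be
      dropped under the integral.\<close>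
    have "(\<integral>\<omega>. indicator ?C \<omega> * X \<omega> \<partial>M) = (\<integral>\<omega>. ?w \<omega> * X \<omega> \<partial>M)"
    proof (rule weighted_integral_eqI[where f = "\<lambda>x. x"])
      fix B :: "real set" assume [measurable]: "B \<in> sets borel"
      let ?B = "X -` B \<inter> space M"
      have eq: "{\<omega> \<in> space M. X \<omega> \<in> B \<and> Y \<omega> \<in> C} = ?B \<inter> ?C" by auto
      have "(\<integral>\<omega>. indicator ?C \<omega> * indicator ?B \<omega> \<partial>M) = (\<integral>\<omega>. indicator (?B \<inter> ?C) \<omega> \<partial>M :: real)"
        by (intro Bochner_Integration.integral_cong) (auto split: split_indicator)
      also have "\<dots> = (\<integral>\<omega>. real_cond_exp M G (indicator (?B \<inter> ?C)) \<omega> \<partial>M)"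
        by (rule G.real_cond_exp_int(2)[symmetric]) simp
      also have "\<dots> = (\<integral>\<omega>. ?w \<omega> * real_cond_exp M G (indicator ?B) \<omega> \<partial>M)"
        using ci[of B C] unfolding cond_law_def cond_prob_def eq
        by (intro integral_cong_AE) (auto simp: borel_measurable_cond_exp2 mult.commute)
      also have "\<dots> = (\<integral>\<omega>. ?w \<omega> * indicator ?B \<omega> \<partial>M)"
        by (intro G.real_cond_exp_intg(2) integrable_real_mult_indicator integrable_cond_exp_indicator G)
           auto
      finally show "(\<integral>\<omega>. indicator ?C \<omega> * indicator ?B \<omega> \<partial>M) = (\<integral>\<omega>. ?w \<omega> * indicator ?B \<omega> \<partial>M)" .
    qed (simp_all add: integrable_cond_exp_indicator cond_exp_indicator_nonneg G)
    \<comment> \<open>Self-adjointness moves the conditioning from the event \<open>?C\<close> to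
      \<open>X\<close>.\<close>
    then show ?thesis
      by (simp add: cond_exp_indicator_self_adjoint G X)
  qed
  \<comment> \<open>By \<open>key\<close>, \<open>X - ?a\<close> integrates to zero over every event
    of \<open>?H\<close>.\<close>
  have "AE \<omega> in M. real_cond_exp M ?H (\<lambda>\<omega>. X \<omega> - ?a \<omega>) \<omega> = 0"
  proof (rule H.real_cond_exp_charact)
    fix A assume "A \<in> sets ?H"
    then obtain C where [measurable]: "C \<in> sets borel" and A: "A = Y -` C \<inter> space M"
      by (auto simp: sets_vimage_algebra2)
    have "integrable M (\<lambda>\<omega>. indicator A \<omega> * Z \<omega>)" if "integrable M Z" for Z :: "'a \<Rightarrow> real"
      using that integrable_mult_indicator[of A M Z] by (simp add: A)
    then show "(\<integral>\<omega>\<in>A. (X \<omega> - ?a \<omega>) \<partial>M) = (\<integral>\<omega>\<in>A. 0 \<partial>M)"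
      using key[of C] X a by (simp add: set_lebesgue_integral_def right_diff_distrib A)
  qed (use X a in auto)
  then have "(\<integral>\<omega>. Y \<omega> * real_cond_exp M ?H (\<lambda>\<omega>. X \<omega> - ?a \<omega>) \<omega> \<partial>M) = (\<integral>\<omega>. 0 \<partial>M)"
    by (intro integral_cong_AE) (auto simp: borel_measurable_cond_exp2)
  \<comment> \<open>\<open>Y\<close> is \<open>?H\<close>-measurable and can be pulled out as a
    whole, which avoids approximation by simple functions.\<close>
  moreover have "(\<integral>\<omega>. Y \<omega> * real_cond_exp M ?H (\<lambda>\<omega>. X \<omega> - ?a \<omega>) \<omega> \<partial>M)
      = (\<integral>\<omega>. Y \<omega> * (X \<omega> - ?a \<omega>) \<partial>M)"
    by (rule H.real_cond_exp_intg(2)[OF XY]) (auto intro: measurable_vimage_algebra1)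
  ultimately show ?thesis by simp
qed

text \<open>Instead of Cauchy-Schwarz, the indicator of the event is bounded below by a quadratic in
  \<open>X\<close> with a free parameter \<open>l\<close>; integrating and optimising over
  \<open>l\<close> gives the bound.\<close>

lemma (in prob_space) Paley_Zygmund:
  assumes [measurable]: "X \<in> borel_measurable M" and sq: "integrable M (\<lambda>\<omega>. (X \<omega>)\<^sup>2)"
    and nn: "AE \<omega> in M. 0 \<le> X \<omega>" and \<theta>: "0 \<le> \<theta>" "\<theta> \<le> 1"
  shows "(1 - \<theta>)\<^sup>2 * (expectation X)\<^sup>2 / expectation (\<lambda>\<omega>. (X \<omega>)\<^sup>2)
    \<le> prob {\<omega> \<in> space M. X \<omega> > \<theta> * expectation X}"
proof -
  let ?m = "expectation X" and ?q = "expectation (\<lambda>\<omega>. (X \<omega>)\<^sup>2)"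
  let ?A = "{\<omega> \<in> space M. X \<omega> > \<theta> * ?m}"
  have X: "integrable M X" by (rule square_integrable_imp_integrable) (auto simp: sq)
  have m: "0 \<le> ?m" using nn by (rule integral_nonneg_AE)
  have q: "0 \<le> ?q" by (rule integral_nonneg_AE) simp
  have lower: "2 * l * ((1 - \<theta>) * ?m) - l\<^sup>2 * ?q \<le> prob ?A" if l: "0 \<le> l" for l
  proof -
    have "(\<integral>\<omega>. 2 * l * (X \<omega> - \<theta> * ?m) - l\<^sup>2 * (X \<omega>)\<^sup>2 \<partial>M) \<le> (\<integral>\<omega>. indicator ?A \<omega> \<partial>M)"
    proof (rule integral_mono_AE)
      show "AE \<omega> in M. 2 * l * (X \<omega> - \<theta> * ?m) - l\<^sup>2 * (X \<omega>)\<^sup>2 \<le> indicator ?A \<omega>"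
        using nn AE_space
      proof eventually_elim
        case (elim \<omega>)
        show ?case
        \<comment> \<open>On \<open>?A\<close> the bound is
          \<open>(1 - l * X)\<^sup>2 \<ge> 0\<close> together with
          \<open>\<theta> * ?m \<ge> 0\<close>; off \<open>?A\<close> the linear term is
          nonpositive.\<close>
        proof (cases "\<omega> \<in> ?A")
          case True
          have "2 * l * (X \<omega> - \<theta> * ?m) \<le> 2 * l * X \<omega>"
            using l m \<theta> by (intro mult_left_mono) auto
          also have "\<dots> \<le> 1 + l\<^sup>2 * (X \<omega>)\<^sup>2"
            using sum_squares_bound[of 1 "l * X \<omega>"] by (simp add: power_mult_distrib)
          finally show ?thesis using True by simp
        next
          case False
          then have "2 * l * (X \<omega> - \<theta> * ?m) \<le> 0"
            using l elim by (intro mult_nonneg_nonpos) auto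
          moreover have "0 \<le> l\<^sup>2 * (X \<omega>)\<^sup>2" by simp
          moreover have "indicator ?A \<omega> = (0 :: real)" using False by simp
          ultimately show ?thesis by linarith
        qed
      qed
    qed (use X sq in \<open>auto simp: integrable_indicator_event\<close>)
    then show ?thesis using X sq by (simp add: prob_space algebra_simps)
  qed
  show ?thesis
  proof (cases "?q = 0")
    case False
    \<comment> \<open>The maximiser of the quadratic in \<open>l\<close> on the left of
      \<open>lower\<close>.\<close>
    let ?l = "(1 - \<theta>) * ?m / ?q"
    have "2 * ?l * ((1 - \<theta>) * ?m) - ?l\<^sup>2 * ?q = (1 - \<theta>)\<^sup>2 * ?m\<^sup>2 / ?q"
      using False by (simp add: field_simps power2_eq_square)
    with lower[of ?l] show ?thesis using q m \<theta> by simp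
  \<comment> \<open>If \<open>?q = 0\<close>, the left side is 0 because division by zero yields
    0.\<close>
  qed simp
qed

section \<open>Comparison with the decoupled sequence\<close>

lemma (in prob_space) decoupled_sum:
  fixes d e :: "nat \<Rightarrow> 'a \<Rightarrow> real"
  assumes filt: "finite_filtration M n F"
    and adapted_d: "adapted_seq n F d" and adapted_e: "adapted_seq n F e"
    and sq_d: "\<forall>i\<in>{1..n}. integrable M (\<lambda>\<omega>. (d i \<omega>)\<^sup>2)"
    and sq_e: "\<forall>i\<in>{1..n}. integrable M (\<lambda>\<omega>. (e i \<omega>)\<^sup>2)"
    and decoupled: "decoupled_given M n F G d e"
  shows expectation_decoupled_sum:
      "expectation (\<lambda>\<omega>. \<Sum>i=1..n. d i \<omega>) = expectation (\<lambda>\<omega>. \<Sum>i=1..n. e i \<omega>)" (is ?E)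
    and variance_sum_le_decoupled:
      "variance (\<lambda>\<omega>. \<Sum>i=1..n. d i \<omega>) \<le> 2 * variance (\<lambda>\<omega>. \<Sum>i=1..n. e i \<omega>)" (is ?V)
proof -
  let ?I = "{1..n}"
  have G: "subalgebra M G" and ci: "cond_indep_vars M G e ?I"
    and law_e: "\<And>i. i \<in> ?I \<Longrightarrow> cond_law_eq M (F (i - 1)) (e i) G (e i)"
    and law_de: "\<And>i. i \<in> ?I \<Longrightarrow> cond_law_eq M (F (i - 1)) (d i) (F (i - 1)) (e i)"
    using decoupled by (auto simp: decoupled_given_def CI_given_def tangent_def)
  have F: "subalgebra M (F i)" if "i \<le> n" for i
    using filt that by (simp add: finite_filtration_def)
  have F': "subalgebra M (F (i - 1))" if "i \<in> ?I" for i
    using that by (intro F) auto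
  have F_mono: "subalgebra (F j) (F i)" if "i \<le> j" "j \<le> n" for i j
    using that
  proof (induction j rule: dec_induct)
    case base
    then show ?case by (simp add: subalgebra_def)
  next
    case (step j)
    then have "subalgebra (F j) (F i)" "subalgebra (F (Suc j)) (F j)"
      using filt by (auto simp: finite_filtration_def)
    then show ?case by (auto simp: subalgebra_def)
  qed
  have meas_F: "d i \<in> borel_measurable (F i)" "e i \<in> borel_measurable (F i)" if "i \<in> ?I" for i
    using adapted_d adapted_e that by (auto simp: adapted_seq_def)
  have meas: "d i \<in> borel_measurable M" "e i \<in> borel_measurable M" if "i \<in> ?I" for i
    using that by (auto intro!: measurable_from_subalg[OF F] meas_F)
  have int: "integrable M (d i)" "integrable M (e i)" if "i \<in> ?I" for i
    using that sq_d sq_e meas by (blast intro: square_integrable_imp_integrable)+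
  note sigma_F = sigma_finite_subalgebraI[OF F'] and sigma_G = sigma_finite_subalgebraI[OF G]
  interpret G: sigma_finite_subalgebra M G by (rule sigma_G)

  \<comment> \<open>Two versions of one variable, equal only almost surely: \<open>a i\<close> is
    measurable for \<open>F (i - 1)\<close>, as the martingale argument for \<open>d\<close>
    requires, and \<open>g i\<close> for \<open>G\<close>, as the conditional argument for
    \<open>e\<close> requires.\<close>
  define a where "a i = real_cond_exp M (F (i - 1)) (d i)" for i
  define g where "g i = real_cond_exp M G (e i)" for i
  have [measurable]: "a i \<in> borel_measurable M" "g i \<in> borel_measurable M" "g i \<in> borel_measurable G" for i
    by (auto simp: a_def g_def borel_measurable_cond_exp2)
  \<comment> \<open>Tangency replaces \<open>d i\<close> by \<open>e i\<close> over
    \<open>F (i - 1)\<close>; the CI property then replaces \<open>F (i - 1)\<close> by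
    \<open>G\<close>.\<close>
  have a_eq_g: "AE \<omega> in M. a i \<omega> = g i \<omega>" if "i \<in> ?I" for i
    unfolding a_def g_def
    using cond_law_eq_cond_exp[OF F'[OF that] F'[OF that] int[OF that] law_de[OF that]]
      cond_law_eq_cond_exp[OF F'[OF that] G int(2)[OF that] int(2)[OF that] law_e[OF that]]
    by eventually_elim simp
  have sq_a: "integrable M (\<lambda>\<omega>. (a i \<omega>)\<^sup>2)" if "i \<in> ?I" for i
    unfolding a_def using that sq_d
    by (intro sigma_finite_subalgebra.integrable_cond_exp_L2 sigma_F int) auto
  have sq_g: "integrable M (\<lambda>\<omega>. (g i \<omega>)\<^sup>2)" if "i \<in> ?I" for i
    unfolding g_def using that sq_e by (intro G.integrable_cond_exp_L2 int) auto

  \<comment> \<open>Orthogonality and second moments of the centred summands\<close>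
  let ?x = "\<lambda>i \<omega>. d i \<omega> - a i \<omega>" and ?y = "\<lambda>i \<omega>. e i \<omega> - g i \<omega>"
  have meas_xy: "?x i \<in> borel_measurable M" "?y i \<in> borel_measurable M" if "i \<in> ?I" for i
    using that meas by auto
  have sq_xy: "integrable M (\<lambda>\<omega>. (?x i \<omega>)\<^sup>2)" "integrable M (\<lambda>\<omega>. (?y i \<omega>)\<^sup>2)" if "i \<in> ?I" for i
    using that sq_d sq_e sq_a sq_g meas by (auto intro!: integrable_diff_L2)
  have x_less: "expectation (\<lambda>\<omega>. ?x i \<omega> * ?x j \<omega>) = 0" if ij: "i \<in> ?I" "j \<in> ?I" "i < j" for i j
  proof -
    \<comment> \<open>From \<open>i < j\<close> follows \<open>i \<le> j - 1\<close>, so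
      \<open>?x i\<close> is already known at time \<open>j - 1\<close> and is orthogonal to the
      martingale difference \<open>?x j\<close>.\<close>
    have "subalgebra (F (j - 1)) (F i)" "subalgebra (F (j - 1)) (F (i - 1))"
      using ij by (auto intro!: F_mono)
    then have "?x i \<in> borel_measurable (F (j - 1))"
      unfolding a_def using meas_F ij
      by (intro borel_measurable_diff) (auto intro: measurable_from_subalg)
    moreover have "integrable M (\<lambda>\<omega>. ?x i \<omega> * d j \<omega>)"
      using ij sq_d sq_xy meas meas_xy by (intro integrable_mult_L2) auto
    ultimately show ?thesis
      unfolding a_def using ij meas
      by (intro sigma_finite_subalgebra.integral_mult_diff_cond_exp sigma_F) auto
  qed
  have x_orth: "expectation (\<lambda>\<omega>. ?x i \<omega> * ?x j \<omega>) = 0" if "i \<in> ?I" "j \<in> ?I" "i \<noteq> j" for i j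
    using x_less[of i j] x_less[of j i] that by (cases i j rule: linorder_cases) (auto simp: mult.commute)
  have y_g: "expectation (\<lambda>\<omega>. Z \<omega> * ?y j \<omega>) = 0"
    if j: "j \<in> ?I" and [measurable]: "Z \<in> borel_measurable G" and sq: "integrable M (\<lambda>\<omega>. (Z \<omega>)\<^sup>2)" for j Z
    unfolding g_def using j meas sq_e sq
    by (intro G.integral_mult_diff_cond_exp integrable_mult_L2)
       (auto intro: measurable_from_subalg[OF G])
  have y_orth: "expectation (\<lambda>\<omega>. ?y i \<omega> * ?y j \<omega>) = 0" if ij: "i \<in> ?I" "j \<in> ?I" "i \<noteq> j" for i j
  proof -
    have ey: "integrable M (\<lambda>\<omega>. e i \<omega> * ?y j \<omega>)"
      using ij sq_e sq_xy meas meas_xy by (intro integrable_mult_L2) auto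
    have gy: "integrable M (\<lambda>\<omega>. g i \<omega> * ?y j \<omega>)"
      using ij sq_g sq_xy meas_xy by (intro integrable_mult_L2) auto
    \<comment> \<open>The part \<open>e i\<close> of \<open>?y i\<close> is handled by conditional
      independence, the part \<open>g i\<close> by \<open>y_g\<close>.\<close>
    have "expectation (\<lambda>\<omega>. e i \<omega> * ?y j \<omega>) = 0"
      unfolding g_def
    proof (rule integral_mult_diff_cond_exp_cond_indep[OF G])
      fix B C :: "real set" assume "B \<in> sets borel" "C \<in> sets borel"
      then have "AE \<omega> in M. cond_prob M G {\<omega> \<in> space M. \<forall>k\<in>{j, i}. e k \<omega> \<in> (if k = j then B else C)} \<omega>
          = (\<Prod>k\<in>{j, i}. cond_law M G (e k) (if k = j then B else C) \<omega>)"
        using ci[unfolded cond_indep_vars_def, rule_format, of "{j, i}" "\<lambda>k. if k = j then B else C"] ij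
        by auto
      then show "AE \<omega> in M. cond_prob M G {\<omega> \<in> space M. e j \<omega> \<in> B \<and> e i \<omega> \<in> C} \<omega>
          = cond_law M G (e j) B \<omega> * cond_law M G (e i) C \<omega>"
        using ij by simp
    qed (use ij int meas ey in \<open>auto simp: g_def\<close>)
    moreover have "expectation (\<lambda>\<omega>. g i \<omega> * ?y j \<omega>) = 0"
      using ij sq_g by (intro y_g) auto
    ultimately show ?thesis
      using ey gy by (simp add: left_diff_distrib)
  qed
  \<comment> \<open>Each side is a second moment minus that of the projection; \<open>d i\<close>
    and \<open>e i\<close> have the same law, and \<open>a i\<close> and \<open>g i\<close> agree
    almost surely.\<close>
  have sq_x_eq_y: "expectation (\<lambda>\<omega>. (?x i \<omega>)\<^sup>2) = expectation (\<lambda>\<omega>. (?y i \<omega>)\<^sup>2)" if i: "i \<in> ?I" for i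
  proof -
    have "expectation (\<lambda>\<omega>. (?x i \<omega>)\<^sup>2) = expectation (\<lambda>\<omega>. (d i \<omega>)\<^sup>2) - expectation (\<lambda>\<omega>. (a i \<omega>)\<^sup>2)"
      unfolding a_def using i sq_d
      by (intro sigma_finite_subalgebra.integral_square_diff_cond_exp sigma_F int) auto
    moreover have "expectation (\<lambda>\<omega>. (?y i \<omega>)\<^sup>2) = expectation (\<lambda>\<omega>. (e i \<omega>)\<^sup>2) - expectation (\<lambda>\<omega>. (g i \<omega>)\<^sup>2)"
      unfolding g_def using i sq_e
      by (intro G.integral_square_diff_cond_exp int) auto
    moreover have "expectation (\<lambda>\<omega>. (d i \<omega>)\<^sup>2) = expectation (\<lambda>\<omega>. (e i \<omega>)\<^sup>2)"
      using i meas by (intro cond_law_eq_integral[OF F' F' _ _ _ law_de, where f = "\<lambda>x. x\<^sup>2"]) auto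
    moreover have "expectation (\<lambda>\<omega>. (a i \<omega>)\<^sup>2) = expectation (\<lambda>\<omega>. (g i \<omega>)\<^sup>2)"
      using a_eq_g[OF i] by (intro integral_cong_AE) auto
    ultimately show ?thesis by simp
  qed

  \<comment> \<open>Decomposition of the two variances\<close>
  define m where "m = expectation (\<lambda>\<omega>. \<Sum>i\<in>?I. e i \<omega>)"
  let ?D = "\<lambda>\<omega>. \<Sum>i\<in>?I. ?x i \<omega>" and ?D' = "\<lambda>\<omega>. \<Sum>i\<in>?I. ?y i \<omega>"
  \<comment> \<open>Built from \<open>g\<close> rather than \<open>a\<close>, so that
    \<open>?R\<close> is \<open>G\<close>-measurable and \<open>y_g\<close> applies to it.\<close>
  let ?R = "\<lambda>\<omega>. (\<Sum>i\<in>?I. g i \<omega>) - m"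
  have a_sum: "AE \<omega> in M. (\<Sum>i\<in>?I. a i \<omega>) = (\<Sum>i\<in>?I. g i \<omega>)"
  proof -
    have "AE \<omega> in M. \<forall>i\<in>?I. a i \<omega> = g i \<omega>"
      using a_eq_g by (intro AE_finite_allI) auto
    then show ?thesis by eventually_elim simp
  qed
  have "expectation (d i) = expectation (e i)" if "i \<in> ?I" for i
    using cond_law_eq_integral[OF F' F' _ _ _ law_de, where f = "\<lambda>x. x"] that meas by auto
  then show E: ?E
    using int by simp
  have meas_DR[measurable]: "?D \<in> borel_measurable M" "?D' \<in> borel_measurable M" "?R \<in> borel_measurable M"
    using meas_xy by (auto intro!: borel_measurable_sum)
  have sq_D: "integrable M (\<lambda>\<omega>. (?D \<omega>)\<^sup>2)" "integrable M (\<lambda>\<omega>. (?D' \<omega>)\<^sup>2)"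
    using sq_xy meas_xy by (auto intro!: integrable_sum_L2)
  have sq_R: "integrable M (\<lambda>\<omega>. (?R \<omega>)\<^sup>2)"
    using sq_g by (intro integrable_diff_L2 integrable_sum_L2) auto
  have D_eq: "expectation (\<lambda>\<omega>. (?D \<omega>)\<^sup>2) = expectation (\<lambda>\<omega>. (?D' \<omega>)\<^sup>2)"
  proof -
    have "expectation (\<lambda>\<omega>. (?D \<omega>)\<^sup>2) = (\<Sum>i\<in>?I. expectation (\<lambda>\<omega>. (?x i \<omega>)\<^sup>2))"
      by (rule integral_square_sum_orthogonal[OF _ meas_xy(1) sq_xy(1) x_orth]) simp
    also have "\<dots> = (\<Sum>i\<in>?I. expectation (\<lambda>\<omega>. (?y i \<omega>)\<^sup>2))"
      by (rule sum.cong[OF refl sq_x_eq_y])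
    also have "\<dots> = expectation (\<lambda>\<omega>. (?D' \<omega>)\<^sup>2)"
      by (rule integral_square_sum_orthogonal[OF _ meas_xy(2) sq_xy(2) y_orth, symmetric]) simp
    finally show ?thesis .
  qed
  have Ry_int: "integrable M (\<lambda>\<omega>. ?R \<omega> * ?y i \<omega>)" if "i \<in> ?I" for i
    by (rule integrable_mult_L2[OF meas_DR(3) meas_xy(2)[OF that] sq_R sq_xy(2)[OF that]])
  have "expectation (\<lambda>\<omega>. ?R \<omega> * ?D' \<omega>) = (\<Sum>i\<in>?I. expectation (\<lambda>\<omega>. ?R \<omega> * ?y i \<omega>))"
    unfolding sum_distrib_left by (rule Bochner_Integration.integral_sum[OF Ry_int])
  also have "\<dots> = 0"
  proof (intro sum.neutral ballI)
    fix i assume "i \<in> ?I"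
    moreover have "?R \<in> borel_measurable G" by measurable
    ultimately show "expectation (\<lambda>\<omega>. ?R \<omega> * ?y i \<omega>) = 0" using sq_R by (rule y_g)
  qed
  finally have RD: "expectation (\<lambda>\<omega>. ?R \<omega> * ?D' \<omega>) = 0" .
  have RD_int: "integrable M (\<lambda>\<omega>. ?R \<omega> * ?D' \<omega>)"
    by (rule integrable_mult_L2[OF meas_DR(3,2) sq_R sq_D(2)])
  have "((\<Sum>i\<in>?I. e i \<omega>) - m)\<^sup>2 = (?D' \<omega>)\<^sup>2 + (?R \<omega>)\<^sup>2 + 2 * (?R \<omega> * ?D' \<omega>)" for \<omega>
  proof -
    have "(\<Sum>i\<in>?I. e i \<omega>) - m = ?D' \<omega> + ?R \<omega>" by (simp add: sum_subtractf)
    moreover have "(x + y)\<^sup>2 = x\<^sup>2 + y\<^sup>2 + 2 * (y * x)" for x y :: real by (simp add: power2_sum)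
    ultimately show ?thesis by (simp only:)
  qed
  then have "variance (\<lambda>\<omega>. \<Sum>i\<in>?I. e i \<omega>)
      = expectation (\<lambda>\<omega>. (?D' \<omega>)\<^sup>2 + (?R \<omega>)\<^sup>2 + 2 * (?R \<omega> * ?D' \<omega>))"
    unfolding m_def[symmetric] by (simp only:)
  also have "\<dots> = expectation (\<lambda>\<omega>. (?D' \<omega>)\<^sup>2 + (?R \<omega>)\<^sup>2) + expectation (\<lambda>\<omega>. 2 * (?R \<omega> * ?D' \<omega>))"
    by (rule Bochner_Integration.integral_add[OF Bochner_Integration.integrable_add[OF sq_D(2) sq_R]
          integrable_mult_right[OF RD_int]])
  also have "\<dots> = expectation (\<lambda>\<omega>. (?D' \<omega>)\<^sup>2) + expectation (\<lambda>\<omega>. (?R \<omega>)\<^sup>2)"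
    unfolding Bochner_Integration.integral_add[OF sq_D(2) sq_R] integral_mult_right_zero RD by simp
  finally have var_e: "variance (\<lambda>\<omega>. \<Sum>i\<in>?I. e i \<omega>)
      = expectation (\<lambda>\<omega>. (?D' \<omega>)\<^sup>2) + expectation (\<lambda>\<omega>. (?R \<omega>)\<^sup>2)" .
  have "variance (\<lambda>\<omega>. \<Sum>i\<in>?I. d i \<omega>) \<le> expectation (\<lambda>\<omega>. 2 * (?D \<omega>)\<^sup>2 + 2 * (?R \<omega>)\<^sup>2)"
    unfolding E m_def[symmetric]
  proof (rule integral_mono_AE)
    have dm: "(\<lambda>\<omega>. \<Sum>i\<in>?I. d i \<omega>) \<in> borel_measurable M"
      using meas by (intro borel_measurable_sum) auto
    show "integrable M (\<lambda>\<omega>. ((\<Sum>i\<in>?I. d i \<omega>) - m)\<^sup>2)"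
      using sq_d meas by (intro integrable_diff_L2[OF dm] integrable_sum_L2) auto
    show "integrable M (\<lambda>\<omega>. 2 * (?D \<omega>)\<^sup>2 + 2 * (?R \<omega>)\<^sup>2)"
      by (intro Bochner_Integration.integrable_add integrable_mult_right sq_D(1) sq_R)
    have bound: "(x + y)\<^sup>2 \<le> 2 * x\<^sup>2 + 2 * y\<^sup>2" for x y :: real
      using sum_squares_bound[of x y] by (simp add: power2_sum)
    \<comment> \<open>Only almost sure, because \<open>?D\<close> subtracts the \<open>a i\<close>
      while \<open>?R\<close> adds back the \<open>g i\<close>.\<close>
    show "AE \<omega> in M. ((\<Sum>i\<in>?I. d i \<omega>) - m)\<^sup>2 \<le> 2 * (?D \<omega>)\<^sup>2 + 2 * (?R \<omega>)\<^sup>2"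
      using a_sum
    proof eventually_elim
      case (elim \<omega>)
      then have "(\<Sum>i\<in>?I. d i \<omega>) - m = ?D \<omega> + ?R \<omega>" by (simp add: sum_subtractf)
      then show ?case using bound[of "?D \<omega>" "?R \<omega>"] by (simp only:)
    qed
  qed
  also have "\<dots> = 2 * expectation (\<lambda>\<omega>. (?D \<omega>)\<^sup>2) + 2 * expectation (\<lambda>\<omega>. (?R \<omega>)\<^sup>2)"
    unfolding Bochner_Integration.integral_add[OF integrable_mult_right[OF sq_D(1)]
        integrable_mult_right[OF sq_R]] integral_mult_right_zero ..
  finally show ?V
    by (simp only: var_e D_eq distrib_left[of 2 "expectation (\<lambda>\<omega>. (?D' \<omega>)\<^sup>2)"])
qed

text \<open>The equality of the two lower bounds is stated for nonzero mean: at mean 0, with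
  division by zero yielding 0, the first fraction is 0 and the second is -1.\<close>

theorem theorem3p6:
  fixes M :: "'a measure" and n :: nat
    and F :: "nat \<Rightarrow> 'a measure" and G :: "'a measure"
    and d e :: "nat \<Rightarrow> 'a \<Rightarrow> real"
    and S S' :: "'a \<Rightarrow> real"
  assumes prob: "prob_space M"
    and filt: "finite_filtration M n F"
    and adapted_d: "adapted_seq n F d"
    and adapted_e: "adapted_seq n F e"
    and sq_d: "\<forall>i\<in>{1..n}. integrable M (\<lambda>\<omega>. (d i \<omega>)\<^sup>2)"
    and sq_e: "\<forall>i\<in>{1..n}. integrable M (\<lambda>\<omega>. (e i \<omega>)\<^sup>2)"
    and decoupled: "decoupled_given M n F G d e"
    and S: "S = (\<lambda>\<omega>. \<Sum>i=1..n. d i \<omega>)"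
    and S': "S' = (\<lambda>\<omega>. \<Sum>i=1..n. e i \<omega>)"
  shows "(\<forall>t>0. measure M {\<omega>\<in>space M. \<bar>S \<omega> - prob_space.expectation M S\<bar> > t}
                  \<le> 2 * prob_space.variance M S' / t\<^sup>2)
    \<and> ((AE \<omega> in M. S \<omega> \<ge> 0) \<longrightarrow>
        (\<forall>\<theta>. 0 < \<theta> \<and> \<theta> < 1 \<longrightarrow>
          measure M {\<omega>\<in>space M. S \<omega> > \<theta> * prob_space.expectation M S}
            \<ge> (1 - \<theta>)\<^sup>2 * ((prob_space.expectation M S)\<^sup>2
                / (2 * prob_space.expectation M (\<lambda>\<omega>. (S' \<omega>)\<^sup>2) - (prob_space.expectation M S)\<^sup>2))
          \<and> (prob_space.expectation M S \<noteq> 0 \<longrightarrow>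
              (1 - \<theta>)\<^sup>2 * ((prob_space.expectation M S)\<^sup>2
                / (2 * prob_space.expectation M (\<lambda>\<omega>. (S' \<omega>)\<^sup>2) - (prob_space.expectation M S)\<^sup>2))
              = (1 - \<theta>)\<^sup>2 * (1
                / (2 * prob_space.expectation M (\<lambda>\<omega>. (S' \<omega>)\<^sup>2) / (prob_space.expectation M S)\<^sup>2 - 1)))))"
proof -
  interpret prob_space M by (rule prob)
  have F: "subalgebra M (F i)" if "i \<in> {1..n}" for i
    using filt that by (simp add: finite_filtration_def)
  have meas: "d i \<in> borel_measurable M" "e i \<in> borel_measurable M" if "i \<in> {1..n}" for i
    using adapted_d adapted_e that F unfolding adapted_seq_def by (blast intro: measurable_from_subalg)+
  have [measurable]: "S \<in> borel_measurable M" "S' \<in> borel_measurable M"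
    unfolding S S' using meas by (auto intro!: borel_measurable_sum)
  have sq: "integrable M (\<lambda>\<omega>. (S \<omega>)\<^sup>2)" "integrable M (\<lambda>\<omega>. (S' \<omega>)\<^sup>2)"
    unfolding S S' using meas sq_d sq_e by (auto intro!: integrable_sum_L2)
  then have int: "integrable M S" "integrable M S'"
    by (auto intro: square_integrable_imp_integrable)
  have E: "expectation S = expectation S'" and V: "variance S \<le> 2 * variance S'"
    unfolding S S'
    using decoupled_sum[OF filt adapted_d adapted_e sq_d sq_e decoupled] by auto
  let ?m = "expectation S" and ?r = "2 * expectation (\<lambda>\<omega>. (S' \<omega>)\<^sup>2) - (expectation S)\<^sup>2"
  \<comment> \<open>With the common mean, \<open>V\<close> reads \<open>E[S\<^sup>2] - ?m\<^sup>2
    \<le> 2 * (E[S'\<^sup>2] - ?m\<^sup>2)\<close>; one \<open>?m\<^sup>2\<close> cancels.\<close>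
  have second: "expectation (\<lambda>\<omega>. (S \<omega>)\<^sup>2) \<le> ?r"
    using V unfolding variance_eq[OF int(1) sq(1)] variance_eq[OF int(2) sq(2)] by (simp add: E)
  have m_sq: "?m\<^sup>2 \<le> expectation (\<lambda>\<omega>. (S \<omega>)\<^sup>2)"
    using variance_positive[of S] unfolding variance_eq[OF int(1) sq(1)] by simp
  have tail: "prob {\<omega> \<in> space M. \<bar>S \<omega> - ?m\<bar> > t} \<le> 2 * variance S' / t\<^sup>2" if "t > 0" for t
  proof -
    \<comment> \<open>Chebyshev is available for the event with a non-strict inequality.\<close>
    have "prob {\<omega> \<in> space M. \<bar>S \<omega> - ?m\<bar> > t} \<le> prob {\<omega> \<in> space M. \<bar>S \<omega> - ?m\<bar> \<ge> t}"
      by (intro finite_measure_mono) auto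
    also have "\<dots> \<le> variance S / t\<^sup>2"
      using that sq by (intro Chebyshev_inequality) auto
    also have "\<dots> \<le> 2 * variance S' / t\<^sup>2"
      using V by (intro divide_right_mono) auto
    finally show ?thesis .
  qed
  have lower: "(1 - \<theta>)\<^sup>2 * (?m\<^sup>2 / ?r) \<le> prob {\<omega> \<in> space M. S \<omega> > \<theta> * ?m}"
    if nn: "AE \<omega> in M. S \<omega> \<ge> 0" and \<theta>: "0 < \<theta>" "\<theta> < 1" for \<theta>
  proof (cases "?m = 0")
    case False
    \<comment> \<open>Both denominators compared below are at least \<open>?m\<^sup>2 > 0\<close>;
      in the case \<open>?m = 0\<close> the claimed bound is 0.\<close>
    then have "0 < expectation (\<lambda>\<omega>. (S \<omega>)\<^sup>2)"
      using m_sq by (smt (verit) zero_less_power2)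
    then have "?m\<^sup>2 / ?r \<le> ?m\<^sup>2 / expectation (\<lambda>\<omega>. (S \<omega>)\<^sup>2)"
      using second by (intro divide_left_mono) auto
    then have "(1 - \<theta>)\<^sup>2 * (?m\<^sup>2 / ?r) \<le> (1 - \<theta>)\<^sup>2 * (?m\<^sup>2 / expectation (\<lambda>\<omega>. (S \<omega>)\<^sup>2))"
      by (intro mult_left_mono) auto
    also have "\<dots> \<le> prob {\<omega> \<in> space M. S \<omega> > \<theta> * ?m}"
      using Paley_Zygmund[of S \<theta>] nn sq \<theta> by simp
    finally show ?thesis .
  qed simp
  have ratio: "?m\<^sup>2 / ?r = 1 / (2 * expectation (\<lambda>\<omega>. (S' \<omega>)\<^sup>2) / ?m\<^sup>2 - 1)" if "?m \<noteq> 0"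
  proof -
    have "2 * expectation (\<lambda>\<omega>. (S' \<omega>)\<^sup>2) / ?m\<^sup>2 - 1 = ?r / ?m\<^sup>2"
      using that by (simp add: diff_divide_distrib)
    then show ?thesis by simp
  qed
  show ?thesis
    by (intro conjI allI impI) (simp_all only: tail lower ratio not_False_eq_True)
qed

end
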